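(* Let $f:[0,1]\to[0,1]$ be a continuous surjective function. Then the inverse limit $\varprojlim f$ is an arc if and only if $f$ does not admit a splitting sequence.
   Context: For a continuous $f:[0,1]\to[0,1]$, the inverse limit is $\varprojlim f=\{\mathbf x=(x_0,x_1,\dots)\in[0,1]^{\mathbb N}: f(x_{n+1})=x_n\text{ for all }n\in\mathbb N\}$ with the topology inherited from the product topology. An arc is a continuum homeomorphic to $[0,1]$. A sequence $(T_n)_{n\in\mathbb N}$ of closed intervals $T_n\subsetneq[0,1]$ (possibly degenerate) is tight (for $f$) if $f(T_{n+1})=T_n$ for every $n$ and there is $m\in\mathbb N$ such that $T_n$ is nondegenerate for all $n>m$. A tight sequence $(T_n)_{n\in\mathbb N}$, $T_n=[l_n,r_n]$, is a splitting sequence admitted by $f$ if there exist an infinite set $N\subseteq\mathbb N$ and nondegenerate closed intervals $S_n\subseteq[0,1]$ ($n\in N$) such that for each $n\in N$, $S_n\cap T_n\subseteq\{l_n,r_n\}$ and $f(S_n)=f(T_n)$. "$f$ admits a splitting sequence" means such a sequence exists. *)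

theory Defs
  imports "HOL-Analysis.Analysis"
begin

text \<open>The inverse limit of f on [0,1], as a subset of nat => real, which carries the
  product topology (Function_Topology instance); it is thus a subspace of the product.\<close>
definition invlim :: "(real \<Rightarrow> real) \<Rightarrow> (nat \<Rightarrow> real) set" where
  "invlim f = {x. (\<forall>n. x n \<in> {0..1}) \<and> (\<forall>n. f (x (Suc n)) = x n)}"

definition tight :: "(real \<Rightarrow> real) \<Rightarrow> (nat \<Rightarrow> real) \<Rightarrow> (nat \<Rightarrow> real) \<Rightarrow> bool" where
  "tight f l r \<longleftrightarrow>
     (\<forall>n. 0 \<le> l n \<and> l n \<le> r n \<and> r n \<le> 1 \<and> {l n..r n} \<noteq> {0..1}) \<and>
     (\<forall>n. f ` {l (Suc n)..r (Suc n)} = {l n..r n}) \<and>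
     (\<exists>m. \<forall>n>m. l n < r n)"

definition splitting_sequence :: "(real \<Rightarrow> real) \<Rightarrow> (nat \<Rightarrow> real) \<Rightarrow> (nat \<Rightarrow> real) \<Rightarrow> bool" where
  "splitting_sequence f l r \<longleftrightarrow> tight f l r \<and>
     (\<exists>N S. infinite (N :: nat set) \<and>
        (\<forall>n\<in>N. (\<exists>a b. 0 \<le> a \<and> a < b \<and> b \<le> 1 \<and> S n = {a..b::real}) \<and>
               S n \<inter> {l n..r n} \<subseteq> {l n, r n} \<and>
               f ` S n = f ` {l n..r n}))"

definition admits_splitting_sequence :: "(real \<Rightarrow> real) \<Rightarrow> bool" where
  "admits_splitting_sequence f \<longleftrightarrow> (\<exists>l r. splitting_sequence f l r)"

end

theory Submission
  imports Defs
begin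

text \<open>
  A crossing of \<open>[u, v]\<close> is an interval whose endpoints \<open>f\<close> maps to \<open>u\<close> and \<open>v\<close> and whose interior
  it maps into the open interval \<open>(u, v)\<close>. Distinct crossings of the same interval have disjoint
  interiors. Given points \<open>x \<noteq> y\<close> of the inverse limit, start with a small interval strictly between
  two coordinates \<open>x k\<close> and \<open>y k\<close> and lift it successively to crossings strictly between \<open>x n\<close> and
  \<open>y n\<close>. If infinitely many of these intervals have a second crossing, they form a splitting
  sequence. Otherwise all lifts are unique from some level on, so the lifted intervals separate the
  coordinates of all points near \<open>x\<close> from those of all points near \<open>y\<close>, on the same sides as for
  \<open>x\<close> and \<open>y\<close>. Comparing coordinates along a suitable subsequence of levels therefore defines a
  closed linear order on the inverse limit; being compact and connected, it is an arc.

  Conversely, parametrise an arc by \<open>[0, 1]\<close> and let \<open>g n\<close> be the projections. Intervals that \<open>g n\<close>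
  maps onto \<open>S n\<close> and onto \<open>T n\<close> have the same image under earlier projections, so for large \<open>n\<close>
  they nearly coincide and overlap in an interval of length bounded below. As \<open>g n\<close> is constant on
  the overlap, this contradicts injectivity.
\<close>

section \<open>Crossings of an interval and points separated by them\<close>

definition crossing :: "(real \<Rightarrow> real) \<Rightarrow> real \<Rightarrow> real \<Rightarrow> real \<Rightarrow> real \<Rightarrow> bool" where
  "crossing f u v p q \<longleftrightarrow> 0 \<le> p \<and> p < q \<and> q \<le> 1 \<and>
     (f p = u \<and> f q = v \<or> f p = v \<and> f q = u) \<and>
     (\<forall>t. p < t \<longrightarrow> t < q \<longrightarrow> u < f t \<and> f t < v)"

lemma compact_level_set:
  fixes g :: "real \<Rightarrow> real"
  assumes "continuous_on {a..b} g"
  shows "compact {t \<in> {a..b}. g t = v}"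
proof -
  have "closed {t \<in> {a..b}. g t = v}"
    by (rule continuous_closed_preimage_constant[OF assms]) simp
  moreover have "bounded {t \<in> {a..b}. g t = v}"
    by (rule bounded_subset[of "{a..b}"]) auto
  ultimately show ?thesis by (simp add: compact_eq_bounded_closed)
qed

text \<open>Take \<open>q\<close> as the first point with value \<open>v\<close> and
  \<open>p\<close> as the last point before \<open>q\<close> with value \<open>u\<close>. By the
  intermediate value theorem, a value outside the open interval in between would produce an earlier
  \<open>q\<close> or a later \<open>p\<close>.\<close>

lemma increasing_crossing_exists:
  fixes g :: "real \<Rightarrow> real"
  assumes cont: "continuous_on {a..b} g" and "a \<le> b" "g a \<le> u" "u < v" "v \<le> g b"
  shows "\<exists>p q. a \<le> p \<and> p < q \<and> q \<le> b \<and> g p = u \<and> g q = v \<and>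
           (\<forall>t. p < t \<longrightarrow> t < q \<longrightarrow> u < g t \<and> g t < v)"
proof -
  define Q where "Q = {t \<in> {a..b}. g t = v}"
  have "compact Q" unfolding Q_def by (rule compact_level_set[OF cont])
  moreover have "Q \<noteq> {}"
    using IVT'[of g a v b] assms by (auto simp: Q_def)
  ultimately obtain q where q: "q \<in> Q" "\<And>t. t \<in> Q \<Longrightarrow> q \<le> t"
    using compact_attains_inf[of Q] by auto
  have qab: "a \<le> q" "q \<le> b" "g q = v" using q by (auto simp: Q_def)
  have contq: "continuous_on {a..q} g"
    using cont qab continuous_on_subset by fastforce
  define P where "P = {t \<in> {a..q}. g t = u}"
  have "compact P" unfolding P_def by (rule compact_level_set[OF contq])
  moreover have "P \<noteq> {}"
    using IVT'[of g a u q] assms contq qab by (auto simp: P_def)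
  ultimately obtain p where p: "p \<in> P" "\<And>t. t \<in> P \<Longrightarrow> t \<le> p"
    using compact_attains_sup[of P] by auto
  have pab: "a \<le> p" "p \<le> q" "g p = u" using p by (auto simp: P_def)
  have "p \<noteq> q" using pab qab \<open>u < v\<close> by auto
  have "u < g t \<and> g t < v" if t: "p < t" "t < q" for t
  proof
    show "g t < v"
    proof (rule ccontr)
      assume "\<not> g t < v"
      then obtain s where "a \<le> s" "s \<le> t" "g s = v"
        using IVT'[of g a v t] assms t pab qab continuous_on_subset[OF cont, of "{a..t}"] by auto
      then have "q \<le> s" using q(2)[of s] t qab by (auto simp: Q_def)
      then show False using \<open>s \<le> t\<close> t by linarith
    qed
    show "u < g t"
    proof (rule ccontr)
      assume "\<not> u < g t"
      then obtain s where "t \<le> s" "s \<le> q" "g s = u"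
        using IVT'[of g t u q] assms t pab qab continuous_on_subset[OF contq, of "{t..q}"] by auto
      then have "s \<le> p" using p(2)[of s] t pab by (auto simp: P_def)
      then show False using \<open>t \<le> s\<close> t by linarith
    qed
  qed
  then show ?thesis using pab qab \<open>p \<noteq> q\<close> by (intro exI[of _ p] exI[of _ q]) auto
qed

text \<open>The increasing case applies directly if \<open>s \<le> t\<close>, and after reflecting
  the domain by negation otherwise.\<close>

lemma crossing_exists_between:
  fixes f :: "real \<Rightarrow> real"
  assumes cont: "continuous_on {0..1} f"
    and st: "s \<in> {0..1}" "t \<in> {0..1}" and uv: "f s \<le> u" "u < v" "v \<le> f t"
  shows "\<exists>p q. crossing f u v p q \<and> min s t \<le> p \<and> q \<le> max s t"
proof (cases "s \<le> t")
  case True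
  have "continuous_on {s..t} f" by (rule continuous_on_subset[OF cont]) (use st in auto)
  from increasing_crossing_exists[OF this True uv] obtain p q where
    "s \<le> p \<and> p < q \<and> q \<le> t \<and> f p = u \<and> f q = v \<and>
           (\<forall>t. p < t \<longrightarrow> t < q \<longrightarrow> u < f t \<and> f t < v)" by blast
  then show ?thesis using st True
    by (intro exI[of _ p] exI[of _ q]) (auto simp: crossing_def)
next
  case False
  have "continuous_on {-s..-t} (\<lambda>x. f (- x))"
    by (rule continuous_on_compose2[OF cont]) (use st in \<open>auto intro!: continuous_intros\<close>)
  from increasing_crossing_exists[OF this, of u v] False uv obtain p q where
    pq: "- s \<le> p" "p < q" "q \<le> - t" "f (- p) = u" "f (- q) = v"
      and mid: "\<And>t. p < t \<Longrightarrow> t < q \<Longrightarrow> u < f (- t) \<and> f (- t) < v" by auto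
  have "u < f x \<and> f x < v" if "- q < x" "x < - p" for x
    using mid[of "- x"] that by simp
  then have "crossing f u v (- q) (- p)"
    using pq st unfolding crossing_def by auto
  then show ?thesis using pq False
    by (intro exI[of _ "- q"] exI[of _ "- p"]) auto
qed

lemma crossing_image:
  assumes cont: "continuous_on {0..1} f" and c: "crossing f u v p q"
  shows "f ` {p..q} = {u..v}"
proof
  have "u \<le> v"
    using c dense[of p q] unfolding crossing_def by (meson less_trans less_imp_le)
  have "u \<le> f t \<and> f t \<le> v" if "p \<le> t" "t \<le> q" for t
  proof (cases "t = p \<or> t = q")
    case True then show ?thesis using c \<open>u \<le> v\<close> by (auto simp: crossing_def)
  next
    case False then show ?thesis using c that by (auto simp: crossing_def less_imp_le)
  qed
  then show "f ` {p..q} \<subseteq> {u..v}" by auto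
  have "continuous_on {p..q} f"
    by (rule continuous_on_subset[OF cont]) (use c in \<open>auto simp: crossing_def\<close>)
  then have "connected (f ` {p..q})" by (simp add: connected_continuous_image)
  moreover have "u \<in> f ` {p..q}" "v \<in> f ` {p..q}"
    using c by (auto simp: crossing_def)
  ultimately show "{u..v} \<subseteq> f ` {p..q}"
    by (meson connected_contains_Icc)
qed

text \<open>Interior values of a crossing avoid \<open>u\<close> and \<open>v\<close>, while its
  endpoints take them. So if the interiors meet, no endpoint of one crossing lies inside the other,
  and the two coincide.\<close>

lemma distinct_crossings_meet_at_endpoints:
  assumes "crossing f u v p q" "crossing f u v p' q'" "\<not> (p' = p \<and> q' = q)"
  shows "{p'..q'} \<inter> {p..q} \<subseteq> {p, q}"
proof
  fix t assume t: "t \<in> {p'..q'} \<inter> {p..q}"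
  show "t \<in> {p, q}"
  proof (rule ccontr)
    assume "t \<notin> {p, q}"
    then have pt: "p < t" "t < q" using t by auto
    then have "t \<noteq> p'" "t \<noteq> q'" using assms(1,2) unfolding crossing_def by (metis less_irrefl)+
    then have pt': "p' < t" "t < q'" using t by auto
    have "\<not> p < p'" using assms(1,2) pt pt' unfolding crossing_def by (metis less_irrefl less_trans)
    moreover have "\<not> p' < p" using assms(1,2) pt pt' unfolding crossing_def by (metis less_irrefl less_trans)
    moreover have "\<not> q < q'" using assms(1,2) pt pt' unfolding crossing_def by (metis less_irrefl less_trans)
    moreover have "\<not> q' < q" using assms(1,2) pt pt' unfolding crossing_def by (metis less_irrefl less_trans)
    ultimately show False using assms(3) by auto
  qed
qed

text \<open>Symmetric in \<open>s\<close> and \<open>t\<close>, since \<open>f\<close> may reverse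
  the order of two coordinates from one level to the next. The strict inequalities make separation
  an open condition.\<close>

definition separates :: "real \<Rightarrow> real \<Rightarrow> real \<Rightarrow> real \<Rightarrow> bool" where
  "separates p q s t \<longleftrightarrow> s < p \<and> q < t \<or> t < p \<and> q < s"

lemma separating_crossing_exists:
  assumes cont: "continuous_on {0..1} f" and st: "s \<in> {0..1}" "t \<in> {0..1}"
    and uv: "u < v" "separates u v (f s) (f t)"
  shows "\<exists>p q. crossing f u v p q \<and> separates p q s t"
proof -
  have "\<exists>p q. crossing f u v p q \<and> min s t \<le> p \<and> q \<le> max s t"
    using uv crossing_exists_between[OF cont st, of u v] crossing_exists_between[OF cont st(2,1), of u v]
    unfolding separates_def by (auto simp: min.commute max.commute)
  then obtain p q where pq: "crossing f u v p q" "min s t \<le> p" "q \<le> max s t" by blast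
  \<comment> \<open>The endpoints have values \<open>u\<close> and \<open>v\<close>, whereas
    \<open>f s\<close> and \<open>f t\<close> lie outside the closed interval from \<open>u\<close>
    to \<open>v\<close>.\<close>
  have "s \<noteq> p" "s \<noteq> q" "t \<noteq> p" "t \<noteq> q"
    using pq(1) uv unfolding crossing_def separates_def by (metis less_irrefl less_trans)+
  then have "separates p q s t"
    using pq unfolding separates_def crossing_def by (auto simp: min_def max_def split: if_splits)
  then show ?thesis using pq by blast
qed

section \<open>From branching paths of crossings to splitting sequences\<close>

lemma invlimD:
  assumes "x \<in> invlim f"
  shows "x n \<in> {0..1}" "f (x (Suc n)) = x n"
  using assms by (auto simp: invlim_def)

lemma funpow_unit_interval:
  fixes f :: "real \<Rightarrow> real"
  assumes "continuous_on {0..1} f" "f ` {0..1} = {0..1}"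
  shows "continuous_on {0..1} (f ^^ n)" "(f ^^ n) ` {0..1} = {0..1}"
proof (induction n)
  case (Suc n)
  { case 1 
    have "continuous_on {0..1} (f \<circ> (f ^^ n))"
      using continuous_on_compose[OF Suc(1)] assms(1) Suc(2) by simp
    then show ?case by simp }
  { case 2 show ?case using Suc(2) assms(2) by (metis funpow.simps(2) image_comp) }
qed auto

lemma invlim_funpow:
  assumes "x \<in> invlim f" shows "(f ^^ k) (x (n + k)) = x n"
proof (induction k arbitrary: n)
  case (Suc k)
  then show ?case using invlimD(2)[OF assms, of n] Suc[of "Suc n"] by simp
qed auto

lemma compact_interval_funpow_image:
  fixes f :: "real \<Rightarrow> real"
  assumes f: "continuous_on {0..1} f" "f ` {0..1} = {0..1}"
    and "0 \<le> u" "u \<le> v" "v \<le> 1"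
  shows "(f ^^ k) ` {u..v} = {Inf ((f ^^ k) ` {u..v}) .. Sup ((f ^^ k) ` {u..v})}"
    and "Inf ((f ^^ k) ` {u..v}) \<le> Sup ((f ^^ k) ` {u..v})"
proof -
  let ?A = "(f ^^ k) ` {u..v}"
  have "continuous_on {u..v} (f ^^ k)"
    by (rule continuous_on_subset[OF funpow_unit_interval(1)[OF f]]) (use assms in auto)
  then have c: "connected ?A" "compact ?A" 
    by (auto intro: connected_continuous_image compact_continuous_image)
  have "?A \<noteq> {}" using assms by auto
  then obtain a b where ab: "?A = {a..b}" "a \<le> b"
    using connected_compact_interval_1[of ?A] c
    by (metis atLeastatMost_empty_iff2 )
  show "?A = {Inf ?A .. Sup ?A}" "Inf ?A \<le> Sup ?A" using ab by simp_all
qed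

text \<open>A path of crossings extends downwards by taking images; properness of the intervals only
  has to be checked at the bottom, because \<open>f\<close> is onto.\<close>
lemma splitting_if_crossings_branch:
  fixes f :: "real \<Rightarrow> real"
  assumes f: "continuous_on {0..1} f" "f ` {0..1} = {0..1}"
    and LR0: "0 \<le> L 0" "L 0 < R 0" "R 0 \<le> 1"
    and cr: "\<And>i. crossing f (L i) (R i) (L (Suc i)) (R (Suc i))"
    and proper: "(f ^^ k) ` {L 0..R 0} \<noteq> {0..1}"
    and branch: "\<And>i. \<exists>j\<ge>i. \<exists>p q. crossing f (L j) (R j) p q \<and> \<not> (p = L (Suc j) \<and> q = R (Suc j))"
  shows "admits_splitting_sequence f"
proof -
  \<comment> \<open>From level \<open>k\<close> on the intervals follow the path, shifted by
    \<open>k\<close>; below, they are the images of its first interval under iterates of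
    \<open>f\<close>. Both descriptions agree at level \<open>k\<close>.\<close>
  define l where "l n = (if k \<le> n then L (n - k) else Inf ((f ^^ (k - n)) ` {L 0..R 0}))" for n
  define r where "r n = (if k \<le> n then R (n - k) else Sup ((f ^^ (k - n)) ` {L 0..R 0}))" for n
  have LR: "0 \<le> L i \<and> L i < R i \<and> R i \<le> 1" for i
  proof (cases i)
    case 0 then show ?thesis using LR0 by simp
  next
    case (Suc j) then show ?thesis using cr[of j] by (auto simp: crossing_def)
  qed
  have low: "{l n..r n} = (f ^^ (k - n)) ` {L 0..R 0} \<and> l n \<le> r n" if "n \<le> k" for n
    using compact_interval_funpow_image[OF f, of "L 0" "R 0" "k - n"] LR0 that
    by (cases "n = k") (auto simp: l_def r_def)
  have im: "f ` {l (Suc n)..r (Suc n)} = {l n..r n}" for n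
  proof (cases "k \<le> n")
    case True
    then show ?thesis using crossing_image[OF f(1) cr[of "n - k"]]
      by (simp add: l_def r_def Suc_diff_le)
  next
    case False
    then have "k - n = Suc (k - Suc n)" by simp
    then have "(f ^^ (k - n)) ` {L 0..R 0} = f ` (f ^^ (k - Suc n)) ` {L 0..R 0}"
      by (simp add: image_comp)
    then show ?thesis using low[of n] low[of "Suc n"] False by simp
  qed
  have sub: "{l n..r n} \<subseteq> {0..1} \<and> l n \<le> r n" for n
  proof (cases "k \<le> n")
    case True then show ?thesis using LR[of "n - k"] by (auto simp: l_def r_def)
  next
    case False
    have "(f ^^ (k - n)) ` {L 0..R 0} \<subseteq> {0..1}"
      using funpow_unit_interval(2)[OF f, of "k - n"] LR0 by fastforce
    then show ?thesis using low[of n] False by simp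
  qed
  have "{l n..r n} \<noteq> {0..1}" for n
  proof (induction n)
    case 0 then show ?case using low[of 0] proper by simp
  next
    case (Suc n) then show ?case using im[of n] f(2) by metis
  qed
  moreover have "0 \<le> l n \<and> r n \<le> 1" for n using sub[of n] by auto
  moreover have "l n < r n" if "n > k" for n using LR[of "n - k"] that by (simp add: l_def r_def)
  ultimately have tight: "tight f l r" unfolding tight_def using im sub by blast
  define B where "B n p q \<longleftrightarrow> crossing f (l n) (r n) p q \<and> \<not> (p = l (Suc n) \<and> q = r (Suc n))" for n p q
  \<comment> \<open>A second crossing of the interval at level \<open>n\<close> lies at level
    \<open>Suc n\<close>, where it competes with the next interval of the path.\<close>
  define N where "N = {Suc n | n. k \<le> n \<and> (\<exists>p q. B n p q)}"
  have "infinite N"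
    unfolding infinite_nat_iff_unbounded_le
  proof
    fix m
    obtain j p q where "j \<ge> m" "crossing f (L j) (R j) p q" "\<not> (p = L (Suc j) \<and> q = R (Suc j))"
      using branch[of m] by blast
    then have "B (k + j) p q" unfolding B_def by (simp add: l_def r_def Suc_diff_le)
    then have "Suc (k + j) \<in> N" unfolding N_def by auto
    then show "\<exists>n\<ge>m. n \<in> N" using \<open>j \<ge> m\<close> by (intro exI[of _ "Suc (k + j)"]) auto
  qed
  have "\<exists>T. \<forall>n\<in>N. (\<exists>a b. 0 \<le> a \<and> a < b \<and> b \<le> 1 \<and> T n = {a..b::real}) \<and>
               T n \<inter> {l n..r n} \<subseteq> {l n, r n} \<and> f ` T n = f ` {l n..r n}"
  proof (rule bchoice, rule ballI)
    fix n assume "n \<in> N"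
    then obtain m p q where n: "n = Suc m" "k \<le> m" and B: "B m p q" by (auto simp: N_def)
    have c: "crossing f (l m) (r m) (l n) (r n)"
      using cr[of "m - k"] n by (simp add: l_def r_def Suc_diff_le)
    have c': "crossing f (l m) (r m) p q" "\<not> (p = l n \<and> q = r n)" using B n by (auto simp: B_def)
    have "{p..q} \<inter> {l n..r n} \<subseteq> {l n, r n}"
      by (rule distinct_crossings_meet_at_endpoints[OF c c'])
    moreover have "f ` {p..q} = f ` {l n..r n}"
      using crossing_image[OF f(1)] c c' by metis
    ultimately show "\<exists>T. (\<exists>a b. 0 \<le> a \<and> a < b \<and> b \<le> 1 \<and> T = {a..b::real}) \<and>
               T \<inter> {l n..r n} \<subseteq> {l n, r n} \<and> f ` T = f ` {l n..r n}"
      using c'(1) by (intro exI[of _ "{p..q}"]) (auto simp: crossing_def)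
  qed
  then show ?thesis using tight \<open>infinite N\<close>
    unfolding admits_splitting_sequence_def splitting_sequence_def by blast
qed

text \<open>By continuity, a short interval around the midpoint has an image within distance less
  than 1/2 of a single value, so the image cannot contain both 0 and 1. This starts a path of
  crossings whose image at level 0 is proper.\<close>

lemma small_interval_between:
  fixes f :: "real \<Rightarrow> real"
  assumes f: "continuous_on {0..1} f" "f ` {0..1} = {0..1}"
    and "0 \<le> a" "a < b" "b \<le> 1"
  shows "\<exists>u v. a < u \<and> u < v \<and> v < b \<and> (f ^^ k) ` {u..v} \<noteq> {0..1}"
proof -
  let ?c = "(a + b) / 2"
  have "isCont (f ^^ k) ?c"
    by (rule continuous_on_interior[OF funpow_unit_interval(1)[OF f]]) (use assms in auto)
  then obtain d where d: "d > 0" "\<And>t. dist t ?c < d \<Longrightarrow> dist ((f ^^ k) t) ((f ^^ k) ?c) < 1/2"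
    unfolding continuous_at_eps_delta by (metis half_gt_zero zero_less_one)
  define e where "e = min (d / 2) ((b - a) / 4)"
  have e: "0 < e" "e < d" "e < (b - a) / 2" using d assms by (auto simp: e_def min_def)
  have "(f ^^ k) ` {?c - e..?c + e} \<noteq> {0..1}"
  proof
    assume eq: "(f ^^ k) ` {?c - e..?c + e} = {0..1}"
    have close: "dist y ((f ^^ k) ?c) < 1/2" if "y \<in> {0..1}" for y
    proof -
      from that eq obtain t where "t \<in> {?c - e..?c + e}" "y = (f ^^ k) t" by blast
      then show ?thesis using d(2)[of t] e by (auto simp: dist_real_def abs_if)
    qed
    show False using close[of 0] close[of 1] by (auto simp: dist_real_def abs_if split: if_splits)
  qed
  then show ?thesis using e assms
    by (intro exI[of _ "?c - e"] exI[of _ "?c + e"]) (auto simp: field_simps)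
qed

section \<open>Unique lifts and the orientation of pairs of points\<close>

text \<open>A small interval between differing coordinates lifts level by level to separating
  crossings. Without splitting sequences this path branches only finitely often, so from some level
  on each interval has the next one as its only crossing.\<close>

lemma unique_separating_path:
  fixes f :: "real \<Rightarrow> real"
  assumes f: "continuous_on {0..1} f" "f ` {0..1} = {0..1}"
    and nosplit: "\<not> admits_splitting_sequence f"
    and x: "x \<in> invlim f" and y: "y \<in> invlim f" and "x \<noteq> y"
  shows "\<exists>n P Q. separates (P n) (Q n) (x n) (y n) \<and> (\<forall>m\<ge>n. P m < Q m \<and>
           (\<forall>p q. crossing f (P m) (Q m) p q \<longrightarrow> p = P (Suc m) \<and> q = Q (Suc m)))"
proof -
  obtain k where k: "x k \<noteq> y k" using \<open>x \<noteq> y\<close> by auto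
  have "0 \<le> min (x k) (y k)" "min (x k) (y k) < max (x k) (y k)" "max (x k) (y k) \<le> 1"
    using invlimD(1)[OF x, of k] invlimD(1)[OF y, of k] k by (auto simp: min_def max_def)
  from small_interval_between[OF f this] obtain u v where
    uv: "min (x k) (y k) < u" "u < v" "v < max (x k) (y k)" and small: "(f ^^ k) ` {u..v} \<noteq> {0..1}"
    by blast
  have sep0: "separates u v (x k) (y k)" using uv by (auto simp: separates_def min_def max_def split: if_splits)
  \<comment> \<open>The invariant for dependent choice: the pair \<open>t\<close> holds the
    endpoints at level \<open>k + i\<close>. The last conjunct pins the starting interval, which the
    choice principle would leave open.\<close>
  define G where "G i t \<longleftrightarrow> fst t < snd t \<and> separates (fst t) (snd t) (x (k + i)) (y (k + i)) \<and> (i = 0 \<longrightarrow> t = (u, v))"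
    for i and t :: "real \<times> real"
  have "\<exists>F. \<forall>i. G i (F i) \<and> crossing f (fst (F i)) (snd (F i)) (fst (F (Suc i))) (snd (F (Suc i)))"
  proof (rule dependent_nat_choice)
    show "\<exists>t. G 0 t" using sep0 uv by (auto simp: G_def)
    fix t i assume "G i t"
    then have G: "fst t < snd t" "separates (fst t) (snd t) (f (x (Suc (k + i)))) (f (y (Suc (k + i))))"
      by (auto simp: G_def invlimD(2)[OF x] invlimD(2)[OF y])
    from separating_crossing_exists[OF f(1) invlimD(1)[OF x] invlimD(1)[OF y] this]
    obtain p q where "crossing f (fst t) (snd t) p q" "separates p q (x (Suc (k + i))) (y (Suc (k + i)))" by blast
    then show "\<exists>t'. G (Suc i) t' \<and> crossing f (fst t) (snd t) (fst t') (snd t')"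
      by (intro exI[of _ "(p, q)"]) (auto simp: G_def crossing_def)
  qed
  then obtain F where F: "\<And>i. G i (F i)"
    "\<And>i. crossing f (fst (F i)) (snd (F i)) (fst (F (Suc i))) (snd (F (Suc i)))" by blast
  define L where "L i = fst (F i)" for i
  define R where "R i = snd (F i)" for i
  have F0: "L 0 = u" "R 0 = v" using F(1)[of 0] by (auto simp: G_def L_def R_def)
  have cr: "crossing f (L i) (R i) (L (Suc i)) (R (Suc i))" for i using F(2) by (simp add: L_def R_def)
  have "0 \<le> L 0" "L 0 < R 0" "R 0 \<le> 1"
    using F0 uv invlimD(1)[OF x, of k] invlimD(1)[OF y, of k] by (auto simp: min_def max_def split: if_splits)
  from splitting_if_crossings_branch[OF f this cr] nosplit small F0
  obtain i where i: "\<And>j p q. j \<ge> i \<Longrightarrow> crossing f (L j) (R j) p q \<Longrightarrow> p = L (Suc j) \<and> q = R (Suc j)"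
    by metis
  have "separates (L i) (R i) (x (k + i)) (y (k + i))" using F(1)[of i] by (simp add: G_def L_def R_def)
  moreover have "L j < R j" for j using F(1)[of j] by (simp add: G_def L_def R_def)
  ultimately show ?thesis using i
    by (intro exI[of _ "k + i"] exI[of _ "\<lambda>n. L (n - k)"] exI[of _ "\<lambda>n. R (n - k)"])
       (auto simp: Suc_diff_le)
qed

text \<open>Some crossing separates the coordinates one level up, and by uniqueness it is the given
  next interval. The path thus serves every pair that it separates at level \<open>n\<close>, not
  only the pair it was built from.\<close>

lemma separation_persists:
  assumes f: "continuous_on {0..1} f"
    and uniq: "\<And>m. m \<ge> n \<Longrightarrow> P m < Q m"
      "\<And>m p q. m \<ge> n \<Longrightarrow> crossing f (P m) (Q m) p q \<Longrightarrow> p = P (Suc m) \<and> q = Q (Suc m)"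
    and x: "x \<in> invlim f" and y: "y \<in> invlim f" 
    and "separates (P n) (Q n) (x n) (y n)" and "m \<ge> n"
  shows "separates (P m) (Q m) (x m) (y m)"
  using \<open>m \<ge> n\<close>
proof (induction m rule: dec_induct)
  case base then show ?case by fact
next
  case (step m)
  then have "separates (P m) (Q m) (f (x (Suc m))) (f (y (Suc m)))"
    by (simp add: invlimD(2)[OF x] invlimD(2)[OF y])
  from separating_crossing_exists[OF f invlimD(1)[OF x] invlimD(1)[OF y] uniq(1)[OF step(1)] this]
  show ?case using uniq(2)[OF step(1)] by blast
qed

text \<open>Separation at level \<open>n\<close> is open and persists upwards, so one path separates
  all points near \<open>x\<close> from all points near \<open>y\<close> at every later
  level.\<close>

lemma orientation_locally_constant:
  fixes f :: "real \<Rightarrow> real"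
  assumes f: "continuous_on {0..1} f" "f ` {0..1} = {0..1}"
    and nosplit: "\<not> admits_splitting_sequence f"
    and x: "x \<in> invlim f" and y: "y \<in> invlim f" and "x \<noteq> y"
  shows "\<exists>n U V. open U \<and> open V \<and> x \<in> U \<and> y \<in> V \<and>
           (\<forall>x'\<in>U \<inter> invlim f. \<forall>y'\<in>V \<inter> invlim f. \<forall>m\<ge>n.
              x m < y m \<and> x' m < y' m \<or> y m < x m \<and> y' m < x' m)"
proof -
  from unique_separating_path[OF assms] obtain n P Q where
    sep: "separates (P n) (Q n) (x n) (y n)" and PQ: "\<And>m. m \<ge> n \<Longrightarrow> P m < Q m"
    and uniq: "\<And>m p q. m \<ge> n \<Longrightarrow> crossing f (P m) (Q m) p q \<Longrightarrow> p = P (Suc m) \<and> q = Q (Suc m)"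
    by blast
  have pers: "separates (P m) (Q m) (x' m) (y' m)"
    if "x' \<in> invlim f" "y' \<in> invlim f" "separates (P n) (Q n) (x' n) (y' n)" "m \<ge> n" for x' y' m
    using separation_persists[of f n P Q x' y' m] f(1) PQ uniq that by blast
  \<comment> \<open>For \<open>s\<close> outside the interval at level \<open>n\<close>, this is the
    open half-space of sequences whose coordinate \<open>n\<close> lies on the same side as
    \<open>s\<close>.\<close>
  define H where "H s = (if s < P n then {z::nat \<Rightarrow> real. z n < P n} else {z. Q n < z n})" for s
  have opn: "open (H s)" for s
    unfolding H_def by (auto intro!: open_Collect_less continuous_on_product_coordinates)
  have main: "x m < y m \<and> x' m < y' m \<or> y m < x m \<and> y' m < x' m"
    if x': "x' \<in> H (x n)" "x' \<in> invlim f" and y': "y' \<in> H (y n)" "y' \<in> invlim f" and "m \<ge> n" for x' y' m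
  proof -
    \<comment> \<open>The mixed pairs tie the sides together: as \<open>x\<close> is opposite to
      both \<open>y\<close> and \<open>y'\<close>, these two lie on the same side, and likewise
      \<open>x\<close> and \<open>x'\<close>.\<close>
    have s: "separates (P n) (Q n) (x n) (y' n)" "separates (P n) (Q n) (x' n) (y n)"
      "separates (P n) (Q n) (x' n) (y' n)"
      using sep x'(1) y'(1) PQ[of n] unfolding separates_def H_def by (auto split: if_splits)
    have "separates (P m) (Q m) (x m) (y m)" "separates (P m) (Q m) (x m) (y' m)"
      "separates (P m) (Q m) (x' m) (y m)" "separates (P m) (Q m) (x' m) (y' m)"
      using pers[OF x y sep] pers[OF x y'(2) s(1)] pers[OF x'(2) y s(2)] pers[OF x'(2) y'(2) s(3)] \<open>m \<ge> n\<close>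
      by auto
    then show ?thesis using PQ[OF \<open>m \<ge> n\<close>] unfolding separates_def by argo
  qed
  have "x \<in> H (x n)" "y \<in> H (y n)" using sep PQ[of n] by (auto simp: H_def separates_def)
  then show ?thesis using main opn
    by (intro exI[of _ n] exI[of _ "H (x n)"] exI[of _ "H (y n)"]) auto
qed

section \<open>Embedding a compact linearly ordered space into the reals\<close>

text \<open>For a closed linear order on a compact metric space, the running maximum of a continuous
  function is continuous and monotone; a weighted sum of the running maxima of
  \<open>\<lambda>z. - dist z d\<close> for \<open>d\<close> in a countable dense set is strictly monotone.\<close>
locale compact_linear_order =
  fixes X :: "'a :: {metric_space, second_countable_topology} set" and le :: "'a \<Rightarrow> 'a \<Rightarrow> bool"
  assumes compact: "compact X"
    and refl: "x \<in> X \<Longrightarrow> le x x"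
    and antisym: "x \<in> X \<Longrightarrow> y \<in> X \<Longrightarrow> le x y \<Longrightarrow> le y x \<Longrightarrow> x = y"
    and trans: "x \<in> X \<Longrightarrow> y \<in> X \<Longrightarrow> z \<in> X \<Longrightarrow> le x y \<Longrightarrow> le y z \<Longrightarrow> le x z"
    and total: "x \<in> X \<Longrightarrow> y \<in> X \<Longrightarrow> le x y \<or> le y x"
    and closed: "closed {(x, y). x \<in> X \<and> y \<in> X \<and> le x y}"
begin

definition running_max :: "('a \<Rightarrow> real) \<Rightarrow> 'a \<Rightarrow> real" where
  "running_max g x = Sup (g ` {z \<in> X. le z x})"

lemma le_limit:
  assumes "\<And>n. le (u n) (v n)" "\<And>n. u n \<in> X" "\<And>n. v n \<in> X" "u \<longlonglongrightarrow> a" "v \<longlonglongrightarrow> b"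
  shows "le a b"
proof -
  have "(\<lambda>n. (u n, v n)) \<longlonglongrightarrow> (a, b)" by (intro tendsto_Pair assms)
  then have "(a, b) \<in> {(x, y). x \<in> X \<and> y \<in> X \<and> le x y}"
    by (rule closed_sequentially[OF closed, rotated]) (use assms in auto)
  then show ?thesis by simp
qed

lemma compact_below: assumes "x \<in> X" shows "compact {z \<in> X. le z x}"
proof -
  have "closed ((\<lambda>z. (z, x)) -` {(x, y). x \<in> X \<and> y \<in> X \<and> le x y})"
    by (intro closed_vimage closed continuous_intros)
  moreover have "{z \<in> X. le z x} = X \<inter> ((\<lambda>z. (z, x)) -` {(x, y). x \<in> X \<and> y \<in> X \<and> le x y})"
    using assms by auto
  ultimately show ?thesis using compact by (simp add: compact_Int_closed)
qed

lemma running_max_attained: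
  assumes g: "continuous_on X g" and x: "x \<in> X"
  shows "\<exists>z\<in>X. le z x \<and> running_max g x = g z"
    and "\<And>z. z \<in> X \<Longrightarrow> le z x \<Longrightarrow> g z \<le> running_max g x"
proof -
  let ?B = "{z \<in> X. le z x}"
  have "continuous_on ?B g" by (rule continuous_on_subset[OF g]) auto
  moreover have "?B \<noteq> {}" using refl x by auto
  ultimately obtain z where z: "z \<in> ?B" "\<And>w. w \<in> ?B \<Longrightarrow> g w \<le> g z"
    using continuous_attains_sup[OF compact_below[OF x], of g] by blast
  have "running_max g x = g z"
    unfolding running_max_def by (rule cSup_eq_maximum) (use z in auto)
  with z show "\<exists>z\<in>X. le z x \<and> running_max g x = g z"
    "\<And>z. z \<in> X \<Longrightarrow> le z x \<Longrightarrow> g z \<le> running_max g x" by auto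
qed

lemma running_max_mono:
  assumes g: "continuous_on X g" and "x \<in> X" "y \<in> X" "le x y"
  shows "running_max g x \<le> running_max g y"
  using running_max_attained[OF g \<open>x \<in> X\<close>] running_max_attained(2)[OF g \<open>y \<in> X\<close>] trans assms
  by metis

text \<open>From below: a maximiser \<open>z \<noteq> a\<close> for \<open>a\<close> is eventually
  below \<open>u n\<close>, because the order is closed; if \<open>z = a\<close>, continuity of
  \<open>g\<close> suffices. From above: maximisers for \<open>u n\<close> accumulate by compactness
  at a point below \<open>a\<close>.\<close>

lemma running_max_continuous:
  assumes g: "continuous_on X g"
  shows "continuous_on X (running_max g)"
proof (rule continuous_on_sequentiallyI)
  fix u a assume u: "\<forall>n. u n \<in> X" "a \<in> X" "u \<longlonglongrightarrow> a"
  show "(\<lambda>n. running_max g (u n)) \<longlonglongrightarrow> running_max g a"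
  proof (rule order_tendstoI)
    fix c assume c: "c < running_max g a"
    obtain z where z: "z \<in> X" "le z a" "running_max g a = g z"
      using running_max_attained(1)[OF g \<open>a \<in> X\<close>] by blast
    show "\<forall>\<^sub>F n in sequentially. c < running_max g (u n)"
    proof (cases "z = a")
      case True
      have "(\<lambda>n. g (u n)) \<longlonglongrightarrow> g a"
        using g u unfolding continuous_on_sequentially by (auto simp: o_def)
      then have "\<forall>\<^sub>F n in sequentially. c < g (u n)"
        by (rule order_tendstoD(1)) (use c z True in simp)
      then show ?thesis
        by eventually_elim (use running_max_attained(2)[OF g] u refl in \<open>meson less_le_trans\<close>)
    next
      case False
      have "\<forall>\<^sub>F n in sequentially. le z (u n)"
      proof (rule ccontr)
        assume "\<not> ?thesis"
        then have "\<exists>\<^sub>F n in sequentially. le (u n) z"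
          using total z u by (auto simp: not_eventually elim!: frequently_mono[rotated])
        then have "infinite {n. le (u n) z}"
          by (simp add: frequently_sequentially infinite_nat_iff_unbounded_le)
        then obtain r :: "nat \<Rightarrow> nat" where r: "strict_mono r" "\<And>n. le (u (r n)) z"
          using infinite_enumerate by blast
        have "le a z"
          by (rule le_limit[of "u \<circ> r" "\<lambda>_. z"]) (use r u z LIMSEQ_subseq_LIMSEQ in auto)
        then show False using antisym z u False by blast
      qed
      then show ?thesis
        by eventually_elim (use running_max_attained(2)[OF g] u z c in \<open>metis less_le_trans\<close>)
    qed
  next
    fix c assume c: "running_max g a < c"
    show "\<forall>\<^sub>F n in sequentially. running_max g (u n) < c"
    proof (rule ccontr)
      assume "\<not> ?thesis"
      then have "\<exists>\<^sub>F n in sequentially. c \<le> running_max g (u n)"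
        by (auto simp: not_eventually not_less)
      then have "infinite {n. c \<le> running_max g (u n)}"
        by (simp add: frequently_sequentially infinite_nat_iff_unbounded_le)
      then obtain r :: "nat \<Rightarrow> nat" where r: "strict_mono r" "\<And>n. c \<le> running_max g (u (r n))"
        using infinite_enumerate by blast
      have "\<forall>n. \<exists>z\<in>X. le z (u (r n)) \<and> c \<le> g z"
        using running_max_attained(1)[OF g] u r by metis
      then obtain z where z: "\<And>n. z n \<in> X" "\<And>n. le (z n) (u (r n))" "\<And>n. c \<le> g (z n)" by metis
      obtain b s where bs: "b \<in> X" "strict_mono s" "(z \<circ> s) \<longlonglongrightarrow> b"
        using compact z(1) unfolding compact_def by metis
      have "le b a"
        by (rule le_limit[of "z \<circ> s" "u \<circ> (r \<circ> s)"])
          (use r u z bs in \<open>auto intro!: LIMSEQ_subseq_LIMSEQ strict_mono_o\<close>)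
      moreover have "c \<le> g b"
      proof (rule LIMSEQ_le_const)
        show "(\<lambda>n. g ((z \<circ> s) n)) \<longlonglongrightarrow> g b"
          using g bs z(1) unfolding continuous_on_sequentially by (auto simp: o_def)
      qed (use z in auto)
      ultimately show False using running_max_attained(2)[OF g \<open>a \<in> X\<close> \<open>b \<in> X\<close>] c by simp
    qed
  qed
qed

lemma embeds_into_reals: "\<exists>h :: 'a \<Rightarrow> real. continuous_on X h \<and> inj_on h X"
proof (cases "X = {}")
  case False
  obtain D :: "'a set" where D: "countable D" "\<And>U. open U \<Longrightarrow> U \<noteq> {} \<Longrightarrow> \<exists>d\<in>D. d \<in> U"
    using countable_dense_setE by blast
  then have "D \<noteq> {}" using open_UNIV by blast
  define d where "d = from_nat_into D"
  have d: "\<exists>j. d j \<in> U" if "open U" "U \<noteq> {}" for U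
    using D(2)[OF that] from_nat_into_surj[OF D(1)] unfolding d_def by metis
  \<comment> \<open>Truncation at 1 bounds all terms uniformly, so the weighted series converges
    uniformly.\<close>
  define g where "g j z = - min 1 (dist z (d j))" for j z
  have g: "continuous_on X (g j)" for j
    unfolding g_def by (intro continuous_intros)
  define F where "F j = running_max (g j)" for j
  have bound: "norm (F j x) \<le> 1" if "x \<in> X" for j x
    using running_max_attained(1)[OF g that, of j] unfolding F_def by (auto simp: g_def)
  define h where "h x = (\<Sum>j. (1/2) ^ j * F j x)" for x
  have term_le: "norm ((1/2) ^ j * F j x) \<le> (1/2) ^ j" if "x \<in> X" for j x
    using bound[OF that, of j] by (simp add: abs_mult mult_left_le)
  have summ: "summable (\<lambda>j. (1/2) ^ j * F j x)" if "x \<in> X" for x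
    by (rule summable_comparison_test'[of "\<lambda>j. (1/2) ^ j" 0]) (use term_le[OF that] in auto)
  have "uniform_limit X (\<lambda>n x. \<Sum>j<n. (1/2) ^ j * F j x) h sequentially"
    unfolding h_def by (rule Weierstrass_m_test) (use term_le in auto)
  then have "continuous_on X h"
    by (rule uniform_limit_theorem[rotated])
      (auto intro!: continuous_intros always_eventually running_max_continuous g simp: F_def)
  moreover have less: "h x < h y" if x: "x \<in> X" and y: "y \<in> X" and "le x y" "x \<noteq> y" for x y
  proof -
    have "y \<notin> {z \<in> X. le z x}" using antisym that by blast
    moreover have "open (- {z \<in> X. le z x})"
      using compact_imp_closed[OF compact_below[OF x]] by (rule open_Compl)
    ultimately obtain e where e: "e > 0" and ball: "ball y e \<subseteq> - {z \<in> X. le z x}"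
      by (auto elim!: openE)
    \<comment> \<open>Points below \<open>x\<close> have distance at least \<open>e\<close> from
      \<open>y\<close>, so \<open>d j\<close> is closer to \<open>y\<close> than to any of them. The
      bound 1/2 keeps the distance from \<open>y\<close> below the truncation.\<close>
    obtain j where j: "d j \<in> ball y (min (e/2) (1/2))"
      using d[OF open_ball, of y "min (e/2) (1/2)"] e by (metis centre_in_ball empty_iff half_gt_zero min_less_iff_conj zero_less_one)
    have "F j x < F j y"
    proof -
      obtain z where z: "z \<in> X" "le z x" "F j x = g j z"
        using running_max_attained(1)[OF g x] unfolding F_def by blast
      have "e \<le> dist y z" using ball z by (auto simp: subset_iff not_less[symmetric])
      moreover have "dist y z \<le> dist y (d j) + dist z (d j)" by (rule dist_triangle2)
      moreover have "dist y (d j) < e/2" "dist y (d j) < 1/2" using j by auto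
      ultimately have "g j z < g j y" unfolding g_def by linarith
      also have "g j y \<le> F j y" using running_max_attained(2)[OF g y y] refl y by (simp add: F_def)
      finally show ?thesis using z by simp
    qed
    moreover have "F i x \<le> F i y" for i using running_max_mono[OF g] that by (simp add: F_def)
    ultimately have "0 < (\<Sum>i. (1/2) ^ i * F i y - (1/2) ^ i * F i x)"
      by (intro suminf_pos2[where i = j] summable_diff summ that) auto
    then show ?thesis unfolding h_def by (simp add: suminf_diff[symmetric] summ that)
  qed
  then have "inj_on h X" unfolding inj_on_def using total by (metis less_irrefl)
  ultimately show ?thesis by blast
qed auto

end

section \<open>Compactness, projections and connectedness of the inverse limit\<close>

text \<open>Tychonoff's theorem, used for the inverse limit itself and for extracting a subsequence
  along which countably many signs converge.\<close>

lemma compact_cube: "compact {w :: nat \<Rightarrow> real. \<forall>j. w j \<in> {a..b}}"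
proof -
  have "compactin (product_topology (\<lambda>_. euclidean) UNIV) (PiE UNIV (\<lambda>_::nat. {a..b}))"
    by (simp add: compactin_PiE)
  then show ?thesis by (simp add: euclidean_product_topology PiE_def Pi_def)
qed

lemma tendsto_coordinate:
  fixes u :: "nat \<Rightarrow> 'i \<Rightarrow> 'b::topological_space"
  assumes "u \<longlonglongrightarrow> x" shows "(\<lambda>n. u n k) \<longlonglongrightarrow> x k"
  using continuous_on_tendsto_compose[OF continuous_on_product_coordinates[of k] assms] by simp

lemma compact_invlim:
  assumes f: "continuous_on {0..1} f"
  shows "compact (invlim f)"
proof -
  let ?C = "{w :: nat \<Rightarrow> real. \<forall>j. w j \<in> {0..1}}"
  have "closed (invlim f)"
    unfolding closed_sequential_limits
  proof (intro allI impI)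
    fix u x assume "(\<forall>n. u n \<in> invlim f) \<and> u \<longlonglongrightarrow> x"
    then have u: "\<And>n. u n \<in> invlim f" and lim: "\<And>k. (\<lambda>n. u n k) \<longlonglongrightarrow> x k"
      by (auto intro: tendsto_coordinate)
    have x01: "x k \<in> {0..1}" for k
      by (rule closed_sequentially[OF _ _ lim]) (use invlimD(1)[OF u] in auto)
    moreover have "f (x (Suc k)) = x k" for k
    proof (rule LIMSEQ_unique)
      show "(\<lambda>n. u n k) \<longlonglongrightarrow> x k" by (rule lim)
      have "(\<lambda>n. f (u n (Suc k))) \<longlonglongrightarrow> f (x (Suc k))"
        using f x01[of "Suc k"] invlimD(1)[OF u] lim[of "Suc k"]
        unfolding continuous_on_sequentially by (auto simp: o_def)
      then show "(\<lambda>n. u n k) \<longlonglongrightarrow> f (x (Suc k))" using invlimD(2)[OF u] by simp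
    qed
    ultimately show "x \<in> invlim f" by (simp add: invlim_def)
  qed
  moreover have "invlim f = ?C \<inter> invlim f" by (auto simp: invlim_def)
  ultimately show ?thesis using compact_Int_closed[OF compact_cube[of 0 1]] by metis
qed

text \<open>Starting from \<open>t\<close> at level \<open>n\<close>, preimages are chosen upwards
  by surjectivity and iterates of \<open>f\<close> fill the levels below.\<close>

lemma invlim_projection_onto:
  assumes f: "f ` {0..1} = {0..1}"
  shows "(\<lambda>x. x n) ` invlim f = {0..1}"
proof
  show "(\<lambda>x. x n) ` invlim f \<subseteq> {0..1}" using invlimD(1) by auto
  show "{0..1} \<subseteq> (\<lambda>x. x n) ` invlim f"
  proof
    fix t :: real assume t: "t \<in> {0..1}"
    have "\<exists>w. \<forall>i. (w i \<in> {0..1} \<and> (i = 0 \<longrightarrow> w i = t)) \<and> f (w (Suc i)) = w i"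
    proof (rule dependent_nat_choice)
      fix s :: real and i :: nat assume "s \<in> {0..1} \<and> (i = 0 \<longrightarrow> s = t)"
      then have "s \<in> f ` {0..1}" using f by simp
      then show "\<exists>s'. (s' \<in> {0..1} \<and> (Suc i = 0 \<longrightarrow> s' = t)) \<and> f s' = s" by auto
    qed (use t in auto)
    then obtain w where w: "\<And>i. w i \<in> {0..1}" "w 0 = t" "\<And>i. f (w (Suc i)) = w i" by blast
    define x where "x i = (if n \<le> i then w (i - n) else (f ^^ (n - i)) t)" for i
    have "(f ^^ i) t \<in> {0..1}" for i
    proof (induction i)
      case (Suc i) then show ?case using f by (metis funpow.simps(2) comp_apply image_eqI)
    qed (use t in simp)
    then have "x i \<in> {0..1}" for i using w(1) by (simp add: x_def)
    moreover have "f (x (Suc i)) = x i" for i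
    proof (cases "n \<le> i")
      case True then show ?thesis using w by (simp add: x_def Suc_diff_le)
    next
      case False
      then have "n - i = Suc (n - Suc i)" by simp
      then show ?thesis using False w by (cases "n = Suc i") (auto simp: x_def)
    qed
    ultimately have "x \<in> invlim f" by (simp add: invlim_def)
    moreover have "x n = t" using w by (simp add: x_def)
    ultimately show "t \<in> (\<lambda>x. x n) ` invlim f" by force
  qed
qed

text \<open>With \<open>C\<close> the whole space, this says that disjoint compact subsets of the inverse
  limit have disjoint projections from some level on; with \<open>C = {(s, t). e \<le> dist s t}\<close> it bounds
  the fibres of late projections.\<close>
lemma compact_agreement:
  fixes \<pi> :: "nat \<Rightarrow> 'a::metric_space \<Rightarrow> real"
  assumes "compact A" "compact B"
    and cont: "\<And>k. continuous_on A (\<pi> k)" "\<And>k. continuous_on B (\<pi> k)" and C: "closed C"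
    and ex: "\<And>n. \<exists>a\<in>A. \<exists>b\<in>B. (a, b) \<in> C \<and> (\<forall>k\<le>n. \<pi> k a = \<pi> k b)"
  shows "\<exists>a\<in>A. \<exists>b\<in>B. (a, b) \<in> C \<and> (\<forall>k. \<pi> k a = \<pi> k b)"
proof -
  have "\<forall>n. \<exists>z. z \<in> A \<times> B \<and> z \<in> C \<and> (\<forall>k\<le>n. \<pi> k (fst z) = \<pi> k (snd z))"
  proof
    fix n
    obtain a b where "a \<in> A" "b \<in> B" "(a, b) \<in> C" "\<forall>k\<le>n. \<pi> k a = \<pi> k b" using ex[of n] by blast
    then show "\<exists>z. z \<in> A \<times> B \<and> z \<in> C \<and> (\<forall>k\<le>n. \<pi> k (fst z) = \<pi> k (snd z))"
      by (intro exI[of _ "(a, b)"]) simp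
  qed
  then obtain z where z: "\<And>n. z n \<in> A \<times> B" "\<And>n. z n \<in> C" "\<And>n k. k \<le> n \<Longrightarrow> \<pi> k (fst (z n)) = \<pi> k (snd (z n))"
    by metis
  obtain c r where c: "c \<in> A \<times> B" "strict_mono r" "(z \<circ> r) \<longlonglongrightarrow> c"
    using compact_Times[OF assms(1,2)] z(1) unfolding compact_def by metis
  have "c \<in> C" by (rule closed_sequentially[OF C _ c(3)]) (use z in auto)
  moreover have "\<pi> k (fst c) = \<pi> k (snd c)" for k
  proof (rule LIMSEQ_unique)
    have "(\<lambda>n. fst ((z \<circ> r) n)) \<longlonglongrightarrow> fst c" "(\<lambda>n. snd ((z \<circ> r) n)) \<longlonglongrightarrow> snd c"
      using c(3) by (rule tendsto_fst, rule tendsto_snd)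
    then have l: "(\<lambda>n. \<pi> k (fst ((z \<circ> r) n))) \<longlonglongrightarrow> \<pi> k (fst c)" "(\<lambda>n. \<pi> k (snd ((z \<circ> r) n))) \<longlonglongrightarrow> \<pi> k (snd c)"
      using cont[of k] c(1) z(1) unfolding continuous_on_sequentially 
      by (auto simp: o_def mem_Times_iff)
    show "(\<lambda>n. \<pi> k (fst ((z \<circ> r) n))) \<longlonglongrightarrow> \<pi> k (fst c)" by (rule l)
    have "\<forall>\<^sub>F n in sequentially. \<pi> k (snd ((z \<circ> r) n)) = \<pi> k (fst ((z \<circ> r) n))"
      using eventually_ge_at_top[of k]
    proof eventually_elim
      case (elim n)
      then show ?case using z(3)[of k "r n"] seq_suble[OF c(2), of n] by simp
    qed
    then show "(\<lambda>n. \<pi> k (fst ((z \<circ> r) n))) \<longlonglongrightarrow> \<pi> k (snd c)"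
      using l(2) by (rule Lim_transform_eventually[rotated])
  qed
  ultimately show ?thesis using c(1) by (metis mem_Times_iff prod.collapse)
qed

lemma invlim_agree_below:
  assumes "x \<in> invlim f" "y \<in> invlim f" "x n = y n" "k \<le> n" shows "x k = y k"
  using invlim_funpow[OF assms(1), of "n - k" k] invlim_funpow[OF assms(2), of "n - k" k] assms(3,4) by simp

text \<open>The projections of two separating pieces are closed and cover the connected
  \<open>{0..1}\<close>, so at each level they meet. By \<open>compact_agreement\<close> the pieces
  then share a point.\<close>

lemma connected_invlim:
  assumes f: "continuous_on {0..1} f" "f ` {0..1} = {0..1}"
  shows "connected (invlim f)"
proof (rule ccontr)
  assume "\<not> ?thesis"
  then obtain A B where AB: "closed A" "closed B" "invlim f \<subseteq> A \<union> B" "A \<inter> B \<inter> invlim f = {}"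
    "A \<inter> invlim f \<noteq> {}" "B \<inter> invlim f \<noteq> {}"
    unfolding connected_closed by blast
  let ?A = "invlim f \<inter> A" and ?B = "invlim f \<inter> B"
  have comp: "compact ?A" "compact ?B" using compact_invlim[OF f(1)] AB by (auto intro: compact_Int_closed)
  have cont: "continuous_on S (\<lambda>x. x k)" for S :: "(nat \<Rightarrow> real) set" and k
    by (rule continuous_on_subset[OF continuous_on_product_coordinates]) simp
  have "\<exists>a\<in>?A. \<exists>b\<in>?B. (a, b) \<in> UNIV \<and> (\<forall>k\<le>n. a k = b k)" for n
  proof (rule ccontr)
    assume no: "\<not> ?thesis"
    define PA where "PA = (\<lambda>x. x n) ` ?A"
    define PB where "PB = (\<lambda>x. x n) ` ?B"
    have "closed PA" "closed PB"
      unfolding PA_def PB_def using comp cont by (blast intro: compact_imp_closed compact_continuous_image)+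
    moreover have "?A \<union> ?B = invlim f" using AB(3) by blast
    then have "PA \<union> PB = {0..1}"
      unfolding PA_def PB_def image_Un[symmetric] using invlim_projection_onto[OF f(2), of n] by simp
    moreover have "PA \<inter> PB = {}"
    proof (rule ccontr)
      assume "PA \<inter> PB \<noteq> {}"
      then obtain a b where ab: "a \<in> ?A" "b \<in> ?B" "a n = b n" unfolding PA_def PB_def by force
      have "\<forall>k\<le>n. a k = b k" using invlim_agree_below[of a f b n] ab by blast
      then show False using no ab(1,2) by blast
    qed
    moreover have "PA \<noteq> {}" "PB \<noteq> {}" using AB(5,6) unfolding PA_def PB_def by auto
    moreover have "connected {0..1::real}" by simp
    ultimately show False
      using connected_closedD[of "{0..1}" PA PB] by auto
  qed
  from compact_agreement[OF comp cont cont closed_UNIV this] obtain a b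
    where "a \<in> ?A" "b \<in> ?B" "\<forall>k. a k = b k" by blast
  moreover from this have "a = b" by blast
  ultimately have "a \<in> A \<inter> B \<inter> invlim f" by blast
  then show False using AB(4) by blast
qed

section \<open>Without splitting sequences the inverse limit is an arc\<close>

lemma arc_if_not_splitting:
  fixes f :: "real \<Rightarrow> real"
  assumes f: "continuous_on {0..1} f" "f ` {0..1} = {0..1}"
    and nosplit: "\<not> admits_splitting_sequence f"
  shows "invlim f homeomorphic {0..1::real}"
proof -
  let ?X = "invlim f"
  note compX = compact_invlim[OF f(1)]
  \<comment> \<open>Two distinct points, needed later to see that the image interval in the reals is
    nondegenerate.\<close>
  obtain x0 where x0: "x0 \<in> ?X" "x0 0 = 0"
    using invlim_projection_onto[OF f(2), of 0] by (auto simp: image_iff set_eq_iff dest: spec[of _ "0::real"])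
  obtain x1 where x1: "x1 \<in> ?X" "x1 0 = 1"
    using invlim_projection_onto[OF f(2), of 0] by (auto simp: image_iff set_eq_iff dest: spec[of _ "1::real"])
  obtain D where D: "countable D" "D \<subseteq> ?X" "?X \<subseteq> closure D" using separable[of ?X] by blast
  then have "D \<noteq> {}" using x0 by auto
  define d where "d = from_nat_into D"
  have dX: "d i \<in> ?X" for i using from_nat_into[OF \<open>D \<noteq> {}\<close>] D unfolding d_def by blast
  have dense: "\<exists>i. d i \<in> U" if "open U" "x \<in> U" "x \<in> ?X" for U x
  proof -
    have "U \<inter> D \<noteq> {}" using D(3) that by (meson closure_iff_nhds_not_empty disjoint_iff open_Int_closure_eq_empty subsetD)
    then show ?thesis using from_nat_into_surj[OF D(1)] unfolding d_def by blast
  qed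
  \<comment> \<open>\<open>f\<close> may reverse orientation at every level; along the subsequence \<open>r\<close> the comparison of
    coordinates converges on a countable dense set, hence everywhere.\<close>
  define s where "s n j = sgn (d (fst (prod_decode j)) n - d (snd (prod_decode j)) n)" for n j
  have "s n \<in> {w :: nat \<Rightarrow> real. \<forall>j. w j \<in> {-1..1}}" for n by (auto simp: s_def sgn_real_def)
  then obtain w r where r: "strict_mono r" "(s \<circ> r) \<longlonglongrightarrow> w"
    using compact_cube[of "-1" 1] unfolding compact_def by metis
  have dcmp: "(\<forall>\<^sub>F n in sequentially. d i (r n) \<le> d j (r n)) \<or> (\<forall>\<^sub>F n in sequentially. d j (r n) \<le> d i (r n))" for i j
  proof -
    let ?k = "prod_encode (i, j)"
    have l: "(\<lambda>n. s (r n) ?k) \<longlonglongrightarrow> w ?k" using tendsto_coordinate[OF r(2), of ?k] by simp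
    show ?thesis
    \<comment> \<open>Signs are -1, 0 or 1: those below 1/2 mean \<open>\<le>\<close>, and positive
      ones mean \<open>>\<close>.\<close>
    proof (cases "w ?k < 1/2")
      case True
      from order_tendstoD(2)[OF l this] have "\<forall>\<^sub>F n in sequentially. d i (r n) \<le> d j (r n)"
        by eventually_elim (auto simp: s_def sgn_real_def split: if_splits)
      then show ?thesis ..
    next
      case False
      then have "0 < w ?k" by simp
      from order_tendstoD(1)[OF l this] have "\<forall>\<^sub>F n in sequentially. d j (r n) \<le> d i (r n)"
        by eventually_elim (auto simp: s_def sgn_real_def split: if_splits)
      then show ?thesis ..
    qed
  qed
  define lt where "lt x y \<longleftrightarrow> (\<forall>\<^sub>F n in sequentially. x (r n) < y (r n))" for x y :: "nat \<Rightarrow> real"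
  have nlt: "\<not> lt x y" if "lt y x" for x y
  proof
    assume "lt x y"
    with that have "\<forall>\<^sub>F n in sequentially. False" unfolding lt_def by eventually_elim simp
    then show False by simp
  qed
  \<comment> \<open>The comparison of dense points \<open>d i\<close> near \<open>x\<close> and
    \<open>d j\<close> near \<open>y\<close> transfers, by the locally constant orientation, to
    \<open>x\<close>, \<open>y\<close> and their neighbours. This yields totality of
    \<open>lt\<close> and closedness of the order.\<close>
  have nbhd: "\<exists>U V. open U \<and> open V \<and> x \<in> U \<and> y \<in> V \<and>
      (\<forall>x'\<in>U \<inter> ?X. \<forall>y'\<in>V \<inter> ?X. lt x' y') \<or> lt y x" if xy: "x \<in> ?X" "y \<in> ?X" "x \<noteq> y" for x y
  proof -
    from orientation_locally_constant[OF assms xy] obtain n U V where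
      UV: "open U" "open V" "x \<in> U" "y \<in> V" and 
      near: "\<forall>x'\<in>U \<inter> ?X. \<forall>y'\<in>V \<inter> ?X. \<forall>m\<ge>n. x m < y m \<and> x' m < y' m \<or> y m < x m \<and> y' m < x' m"
      by (elim exE conjE) (rule that)
    have o: "x m < y m \<and> x' m < y' m \<or> y m < x m \<and> y' m < x' m"
      if "x' \<in> U \<inter> ?X" "y' \<in> V \<inter> ?X" "m \<ge> n" for x' y' m
      using near[rule_format, OF that] .
    obtain i j where ij: "d i \<in> U" "d j \<in> V" using dense UV xy by metis
    have rn: "\<forall>\<^sub>F m in sequentially. n \<le> r m"
      using filterlim_subseq[OF r(1)] by (simp add: filterlim_at_top)
    from dcmp[of i j] show ?thesis
    proof
      assume le: "\<forall>\<^sub>F m in sequentially. d i (r m) \<le> d j (r m)"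
      have "lt x' y'" if x'y': "x' \<in> U \<inter> ?X" "y' \<in> V \<inter> ?X" for x' y'
        unfolding lt_def using le rn
      proof eventually_elim
        case (elim m)
        then show ?case using o[of "d i" "d j" "r m"] o[OF x'y', of "r m"] ij dX by fastforce
      qed
      then show ?thesis using UV by blast
    next
      assume ge: "\<forall>\<^sub>F m in sequentially. d j (r m) \<le> d i (r m)"
      have "lt y x" unfolding lt_def using ge rn
      proof eventually_elim
        case (elim m)
        then show ?case using o[of "d i" "d j" "r m"] ij dX by fastforce
      qed
      then show ?thesis by blast
    qed
  qed
  have lttot: "lt x y \<or> lt y x" if "x \<in> ?X" "y \<in> ?X" "x \<noteq> y" for x y
    using nbhd[OF that] that by blast
  define le where "le x y \<longleftrightarrow> x = y \<or> lt x y" for x y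
  have le_trans: "le x z" if "le x y" "le y z" for x y z
  proof -
    have "lt x z" if "lt x y" "lt y z"
      using that unfolding lt_def by eventually_elim simp
    then show ?thesis using that unfolding le_def by blast
  qed
  have "closed (?X \<times> ?X)" using compX by (simp add: closed_Times compact_imp_closed)
  have "open (- {(x, y). x \<in> ?X \<and> y \<in> ?X \<and> le x y})"
  proof (subst open_subopen, rule ballI)
    fix z assume z: "z \<in> - {(x, y). x \<in> ?X \<and> y \<in> ?X \<and> le x y}"
    show "\<exists>T. open T \<and> z \<in> T \<and> T \<subseteq> - {(x, y). x \<in> ?X \<and> y \<in> ?X \<and> le x y}"
    proof (cases "z \<in> ?X \<times> ?X")
      case False
      then show ?thesis using \<open>closed (?X \<times> ?X)\<close>
        by (intro exI[of _ "- (?X \<times> ?X)"]) auto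
    next
      case True
      obtain x y where xy: "z = (x, y)" "x \<in> ?X" "y \<in> ?X" "\<not> le x y" using z True by auto
      then have "y \<noteq> x" "\<not> lt x y" by (auto simp: le_def)
      with nbhd[of y x] xy obtain U V where UV: "open U" "open V" "y \<in> U" "x \<in> V"
        "\<And>x' y'. y' \<in> U \<inter> ?X \<Longrightarrow> x' \<in> V \<inter> ?X \<Longrightarrow> lt y' x'" by blast
      have "\<not> le x' y'" if "y' \<in> U \<inter> ?X" "x' \<in> V \<inter> ?X" for x' y'
        using UV(5)[OF that] nlt unfolding le_def by blast
      then show ?thesis using UV xy
        by (intro exI[of _ "V \<times> U"]) (auto intro: open_Times)
    qed
  qed
  then have le_closed: "closed {(x, y). x \<in> ?X \<and> y \<in> ?X \<and> le x y}" by (simp add: closed_def)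
  interpret compact_linear_order ?X le
  proof (rule compact_linear_order.intro)
    show "x \<in> ?X \<Longrightarrow> le x x" for x by (simp add: le_def)
    show "x = y" if "le x y" "le y x" for x y using that nlt unfolding le_def by blast
    show "le x y \<or> le y x" if "x \<in> ?X" "y \<in> ?X" for x y using that lttot unfolding le_def by blast
  qed (use compX le_trans le_closed in blast)+
  obtain h :: "(nat \<Rightarrow> real) \<Rightarrow> real" where h: "continuous_on ?X h" "inj_on h ?X"
    using embeds_into_reals by blast
  have "connected (h ` ?X)" "compact (h ` ?X)"
    using h compX connected_invlim[OF f] by (auto intro: connected_continuous_image compact_continuous_image)
  then obtain a b where ab: "h ` ?X = {a..b}"
    using connected_compact_interval_1[of "h ` ?X"] by auto
  have "x0 \<noteq> x1" using x0 x1 by auto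
  then have "h x0 \<noteq> h x1" using h(2) x0 x1 by (simp add: inj_on_eq_iff)
  moreover have "h x0 \<in> {a..b}" "h x1 \<in> {a..b}" using ab x0 x1 by auto
  ultimately have "a < b" by auto
  have "?X homeomorphic {a..b}" by (rule homeomorphic_compact[OF compX h(1) ab h(2)])
  also have "{a..b} homeomorphic {0..1::real}"
    by (rule homeomorphic_closed_intervals_real) (use \<open>a < b\<close> in auto)
  finally show ?thesis .
qed

section \<open>The inverse limit of a map with a splitting sequence is not an arc\<close>

lemma interval_onto_interval:
  fixes g :: "real \<Rightarrow> real"
  assumes g: "continuous_on {0..1} g" "g ` {0..1} = {0..1}" and "0 \<le> u" "u < v" "v \<le> 1"
  shows "\<exists>p q. 0 \<le> p \<and> p < q \<and> q \<le> 1 \<and> g ` {p..q} = {u..v}"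
proof -
  have "u \<in> g ` {0..1}" "v \<in> g ` {0..1}" using assms by auto
  then obtain s t where st: "s \<in> {0..1}" "t \<in> {0..1}" "g s = u" "g t = v" by auto
  from crossing_exists_between[OF g(1) st(1,2), of u v] st assms
  obtain p q where "crossing g u v p q" by auto
  then show ?thesis using crossing_image[OF g(1)] unfolding crossing_def by metis
qed

lemma not_splitting_if_arc:
  fixes f :: "real \<Rightarrow> real"
  assumes f: "continuous_on {0..1} f" "f ` {0..1} = {0..1}"
    and arc: "invlim f homeomorphic {0..1::real}"
  shows "\<not> admits_splitting_sequence f"
proof
  assume "admits_splitting_sequence f"
  then obtain l r where split: "splitting_sequence f l r"
    unfolding admits_splitting_sequence_def by blast
  then have T: "tight f l r" unfolding splitting_sequence_def by blast
  from split obtain N S where N: "infinite (N :: nat set)"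
    and NS: "\<forall>n\<in>N. (\<exists>a b. 0 \<le> a \<and> a < b \<and> b \<le> 1 \<and> S n = {a..b::real}) \<and>
      S n \<inter> {l n..r n} \<subseteq> {l n, r n} \<and> f ` S n = f ` {l n..r n}"
    unfolding splitting_sequence_def by (elim exE conjE) (rule that)
  have S: "\<exists>a b. 0 \<le> a \<and> a < b \<and> b \<le> 1 \<and> S n = {a..b}"
      "S n \<inter> {l n..r n} \<subseteq> {l n, r n}" "f ` S n = f ` {l n..r n}" if "n \<in> N" for n
    using NS[rule_format, OF that] by simp_all
  obtain m where m: "\<And>n. n > m \<Longrightarrow> l n < r n" using T unfolding tight_def by blast
  have T01: "0 \<le> l n" "r n \<le> 1" and Tf: "f ` {l (Suc n)..r (Suc n)} = {l n..r n}" for n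
    using T unfolding tight_def by blast+
  obtain h where h: "continuous_on {0..1::real} h" "h ` {0..1} = invlim f" "inj_on h {0..1}"
    using homeomorphic_sym[THEN iffD1, OF arc] unfolding homeomorphic_def homeomorphism_def
    by (metis inj_on_inverseI)
  define g where "g n t = h t n" for n t
  have hX: "h t \<in> invlim f" if "t \<in> {0..1}" for t using h that by blast
  have gcont: "continuous_on {0..1} (g n)" for n
    unfolding g_def by (rule continuous_on_product_then_coordinatewise[OF h(1)])
  have gonto: "g n ` {0..1} = {0..1}" for n
    using invlim_projection_onto[OF f(2), of n] unfolding g_def h(2)[symmetric] image_image .
  have gf: "g n t = f (g (Suc n) t)" if "t \<in> {0..1}" for n t
    unfolding g_def using invlimD(2)[OF hX[OF that]] by simp
  have g_agree: "g k s = g k t" if "g n s = g n t" "k \<le> n" "s \<in> {0..1}" "t \<in> {0..1}" for k n s t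
    using invlim_agree_below[OF hX hX] that unfolding g_def by blast
  \<comment> \<open>Otherwise parameters at distance at least \<open>e\<close> would agree up to
    arbitrarily high levels, and a limit of such pairs would contradict injectivity of
    \<open>h\<close>.\<close>
  have small_fibres: "\<exists>K. \<forall>n\<ge>K. \<forall>s\<in>{0..1}. \<forall>t\<in>{0..1}. g n s = g n t \<longrightarrow> dist s t < e" if "e > 0" for e
  proof (rule ccontr)
    assume no: "\<not> ?thesis"
    have late: "\<exists>s\<in>{0..1}. \<exists>t\<in>{0..1}. (s, t) \<in> {z. e \<le> dist (fst z) (snd z)} \<and> (\<forall>k\<le>K. g k s = g k t)" for K
    proof -
      obtain n s t where nst: "n \<ge> K" "s \<in> {0..1}" "t \<in> {0..1}" "g n s = g n t" "e \<le> dist s t"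
        using no by (meson not_le)
      have "\<forall>k\<le>K. g k s = g k t" using g_agree[OF nst(4) _ nst(2,3)] nst(1) by simp
      then show ?thesis using nst(2,3,5) by (intro bexI[of _ s] bexI[of _ t]) simp_all
    qed
    have cl: "closed {z :: real \<times> real. e \<le> dist (fst z) (snd z)}"
      by (intro closed_Collect_le continuous_intros)
    have "\<exists>s\<in>{0..1}. \<exists>t\<in>{0..1}. (s, t) \<in> {z. e \<le> dist (fst z) (snd z)} \<and> (\<forall>k. g k s = g k t)"
      by (rule compact_agreement[where \<pi> = g]) (rule compact_Icc gcont cl late)+
    then obtain s t where st: "s \<in> {0..1}" "t \<in> {0..1}" "e \<le> dist s t" "\<forall>k. g k s = g k t"
      by auto
    then have "h s = h t" by (auto simp: g_def)
    then have "s = t" using inj_onD[OF h(3)] st by blast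
    then show False using st \<open>e > 0\<close> by simp
  qed
  have same: "g k ` A = {l k..r k}"
    if "A \<subseteq> {0..1}" "g n ` A = {l n..r n}" "k \<le> n" for A k n
    using that(3,2)
  proof (induction n rule: dec_induct)
    case (step n)
    have "g n ` A = f ` g (Suc n) ` A" unfolding image_image by (rule image_cong[OF HOL.refl], rule gf) (use that(1) in blast)
    then show ?case using step Tf by simp
  qed
  \<comment> \<open>The interval \<open>{l M..r M}\<close> is nondegenerate, so uniform continuity
    of \<open>g M\<close> gives a lower bound \<open>d\<close> on the length of every interval that
    \<open>g M\<close> maps onto it.\<close>
  define M where "M = Suc m"
  have "uniformly_continuous_on {0..1} (g M)" using gcont by (simp add: compact_uniformly_continuous)
  moreover have "0 < r M - l M" using m[of M] by (simp add: M_def)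
  ultimately obtain d where d: "d > 0"
    "\<And>s t. s \<in> {0..1} \<Longrightarrow> t \<in> {0..1} \<Longrightarrow> dist t s < d \<Longrightarrow> dist (g M t) (g M s) < r M - l M"
    unfolding uniformly_continuous_on_def by metis
  have "d / 4 > 0" using d(1) by simp
  from small_fibres[OF this] obtain K where
    "\<forall>n\<ge>K. \<forall>s\<in>{0..1}. \<forall>t\<in>{0..1}. g n s = g n t \<longrightarrow> dist s t < d / 4" ..
  then have K: "dist s t < d / 4" if "n \<ge> K" "s \<in> {0..1}" "t \<in> {0..1}" "g n s = g n t" for n s t
    using that by blast
  \<comment> \<open>The successor keeps the level below \<open>n\<close> at least \<open>K\<close>:
    the images of \<open>S n\<close> and \<open>{l n..r n}\<close> coincide only after one
    application of \<open>f\<close>.\<close>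
  obtain n where n: "n \<in> N" "n \<ge> Suc (K + M)" using N by (meson infinite_nat_iff_unbounded_le)
  obtain u v where uv: "0 \<le> u" "u < v" "v \<le> 1" "S n = {u..v}" using S(1)[OF n(1)] by blast
  obtain a a' where a: "0 \<le> a" "a < a'" "a' \<le> 1" "g n ` {a..a'} = S n"
    using interval_onto_interval[OF gcont[of n] gonto uv(1-3), folded uv(4)] by (elim exE conjE) (rule that)
  have lrn: "l n < r n" using m[of n] n by (simp add: M_def)
  obtain b b' where b: "0 \<le> b" "b < b'" "b' \<le> 1" "g n ` {b..b'} = {l n..r n}"
    using interval_onto_interval[OF gcont[of n] gonto T01(1) lrn T01(2)] by (elim exE conjE) (rule that)
  obtain n' where n': "n = Suc n'" using n by (cases n) auto
  have "g n' ` {a..a'} = f ` g n ` {a..a'}"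
    unfolding image_image n' by (rule image_cong[OF HOL.refl], rule gf) (use a in auto)
  then have "g n' ` {a..a'} = {l n'..r n'}" using a(4) S(3)[OF n(1)] Tf n' by simp
  then have gA: "g K ` {a..a'} = {l K..r K}" using same[of "{a..a'}" n' K] a n n' by auto
  have gB: "g k ` {b..b'} = {l k..r k}" if "k \<le> n" for k using same[of "{b..b'}" n k] b that by auto
  \<comment> \<open>Both parameter intervals have the same image under \<open>g K\<close>, so
    \<open>s\<close> shares a fibre of \<open>g K\<close> with some \<open>t\<close> in
    \<open>{a..a'}\<close>.\<close>
  have nearA: "\<exists>t\<in>{a..a'}. dist s t < d / 4" if "s \<in> {b..b'}" for s
  proof -
    have "g K s \<in> g K ` {a..a'}" using gA gB[of K] that n by auto
    then obtain t where "t \<in> {a..a'}" "g K s = g K t" by auto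
    then show ?thesis using K[of K s t] that a b by auto
  qed
  have "d \<le> b' - b"
  proof (rule ccontr)
    assume "\<not> d \<le> b' - b"
    have "l M \<in> g M ` {b..b'}" "r M \<in> g M ` {b..b'}" using gB[of M] n m[of M] by (auto simp: M_def)
    then obtain s t where st: "s \<in> {b..b'}" "t \<in> {b..b'}" "g M s = l M" "g M t = r M"
      by (metis imageE)
    have "dist t s < d" using st(1,2) \<open>\<not> d \<le> b' - b\<close> by (auto simp: dist_real_def)
    then have "dist (r M) (l M) < r M - l M" using d(2)[of s t] st b by auto
    then show False by (simp add: dist_real_def)
  qed
  moreover have "a < b + d / 4"
  proof -
    obtain t where "t \<in> {a..a'}" "dist b t < d / 4" using nearA[of b] b by auto
    then show ?thesis unfolding dist_real_def atLeastAtMost_iff by linarith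
  qed
  moreover have "b' - d / 4 < a'"
  proof -
    obtain t where "t \<in> {a..a'}" "dist b' t < d / 4" using nearA[of b'] b by auto
    then show ?thesis unfolding dist_real_def atLeastAtMost_iff by linarith
  qed
  ultimately have sub: "{b + d / 4..b' - d / 4} \<subseteq> {a..a'} \<inter> {b..b'}"
    using d(1) by auto
  \<comment> \<open>On this common part, of length at least \<open>d / 2\<close>, \<open>g n\<close>
    takes at most the two values \<open>l n\<close> and \<open>r n\<close>. By connectedness it is
    constant there, against the fibre bound \<open>d / 4\<close>.\<close>
  let ?J = "{b + d / 4..b' - d / 4}"
  have "g n ` ?J \<subseteq> g n ` {a..a'} \<inter> g n ` {b..b'}" using sub by blast
  then have "g n ` ?J \<subseteq> {l n, r n}" using S(2)[OF n(1)] unfolding a(4) b(4) by (rule subset_trans)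
  then have "finite (g n ` ?J)" by (rule finite_subset) simp
  moreover have "connected (g n ` ?J)"
    by (rule connected_continuous_image[OF continuous_on_subset[OF gcont]]) (use sub b in auto)
  ultimately have "g n ` ?J = {} \<or> (\<exists>c. g n ` ?J = {c})" using connected_finite_iff_sing[of "g n ` ?J"] by simp
  moreover have "b + d / 4 \<in> ?J" "b' - d / 4 \<in> ?J" using \<open>d \<le> b' - b\<close> d(1) by auto
  ultimately have "g n (b + d / 4) = g n (b' - d / 4)"
    by (metis empty_iff imageI singletonD)
  then have "dist (b + d / 4) (b' - d / 4) < d / 4"
    using K[of n "b + d / 4" "b' - d / 4"] n b(1,3) d(1) \<open>d \<le> b' - b\<close> by auto
  then show False using \<open>d \<le> b' - b\<close> d(1) unfolding dist_real_def by linarith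
qed

theorem theorem4p7:
  fixes f :: "real \<Rightarrow> real"
  assumes "continuous_on {0..1} f" and "f ` {0..1} = {0..1}"
  shows "invlim f homeomorphic {0..1::real} \<longleftrightarrow> \<not> admits_splitting_sequence f"
  using arc_if_not_splitting[OF assms] not_splitting_if_arc[OF assms] by blast

end
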